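(* For every permutation graph $G$, we have $\chi_{\mathrm{pcf}}(G)\le 3\chi(G)$.
   Context: Graphs are finite and simple. A permutation graph is an intersection graph of line segments having their two endpoints on two parallel lines, one on each (equivalently, the comparability graph of a poset of dimension at most two). $\chi(G)$ is the chromatic number. A proper conflict-free coloring of $G$ is a proper vertex coloring in which, for every non-isolated vertex $v$, some color appears exactly once in the open neighborhood $N(v)$. $\chi_{\mathrm{pcf}}(G)$ is the least $k$ such that $G$ has a proper conflict-free coloring with $k$ colors. *)

theory Defs
  imports "HOL-Analysis.Analysis" "Graph_Theory.Pair_Digraph"
begin

text \<open>
  A finite simple graph is a \<^locale>\<open>pair_graph\<close>: a finite vertex set with a symmetric,
  irreflexive set of arcs, so an edge is a pair of opposite arcs.
\<close>

definition parallel_lines :: "(real^2) set \<Rightarrow> (real^2) set \<Rightarrow> bool" where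
  "parallel_lines L M \<longleftrightarrow>
     affine L \<and> aff_dim L = 1 \<and> affine M \<and> aff_dim M = 1 \<and> affine_parallel L M \<and> L \<noteq> M"

text \<open>
  Segments are closed, and distinct vertices may have segments with a common endpoint, or even the
  same segment; such segments intersect.
\<close>

definition permutation_graph :: "'a pair_pre_digraph \<Rightarrow> bool" where
  "permutation_graph G \<longleftrightarrow> pair_graph G \<and>
     (\<exists>L M a b. parallel_lines L M \<and>
        (\<forall>v\<in>pverts G. a v \<in> L \<and> b v \<in> M) \<and>
        (\<forall>u\<in>pverts G. \<forall>v\<in>pverts G. u \<noteq> v \<longrightarrow>
           ((u, v) \<in> parcs G \<longleftrightarrow> closed_segment (a u) (b u) \<inter> closed_segment (a v) (b v) \<noteq> {})))"

definition neighborhood :: "'a pair_pre_digraph \<Rightarrow> 'a \<Rightarrow> 'a set" where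
  "neighborhood G v = {u. (v, u) \<in> parcs G}"

definition proper_coloring :: "'a pair_pre_digraph \<Rightarrow> nat \<Rightarrow> ('a \<Rightarrow> nat) \<Rightarrow> bool" where
  "proper_coloring G k c \<longleftrightarrow>
     c ` pverts G \<subseteq> {..<k} \<and> (\<forall>(u, v)\<in>parcs G. c u \<noteq> c v)"

definition pcf_coloring :: "'a pair_pre_digraph \<Rightarrow> nat \<Rightarrow> ('a \<Rightarrow> nat) \<Rightarrow> bool" where
  "pcf_coloring G k c \<longleftrightarrow> proper_coloring G k c \<and>
     (\<forall>v\<in>pverts G. neighborhood G v \<noteq> {} \<longrightarrow>
        (\<exists>i. \<exists>!u. u \<in> neighborhood G v \<and> c u = i))"

text \<open>
  On a finite simple graph an injective coloring witnesses that both minima range over nonempty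
  sets.
\<close>

definition chromatic_number :: "'a pair_pre_digraph \<Rightarrow> nat" where
  "chromatic_number G = (LEAST k. \<exists>c. proper_coloring G k c)"

definition pcf_chromatic_number :: "'a pair_pre_digraph \<Rightarrow> nat" where
  "pcf_chromatic_number G = (LEAST k. \<exists>c. pcf_coloring G k c)"

end

theory Submission
  imports Defs
begin

text \<open>
  A permutation graph has a transitive orientation \<open>P\<close>, and its complement has a transitive
  orientation \<open>Q\<close>. Let \<open>h\<close> be the height function of \<open>P\<close>; its level sets are at most
  \<open>\<chi>(G)\<close> independent sets. A vertex of positive level \<open>i\<close> looks for its uniquely coloured
  neighbour in level \<open>i - 1\<close>, and a non-isolated vertex of level \<open>0\<close> looks for it in the
  highest level that contains a neighbour. With this choice the set \<open>S\<close> of vertices that look into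
  a given level \<open>A\<close> is independent. An inclusion-minimal set \<open>H \<subseteq> A\<close> meeting all neighbourhoods
  of \<open>S\<close> then meets each of them in one element or in two \<open>Q\<close>-consecutive elements, so colouring
  \<open>H\<close> alternately with \<open>1\<close> and \<open>2\<close> and the rest of \<open>A\<close> with \<open>0\<close> suffices: three
  colours for each level.
\<close>

section \<open>Crossing of segments between parallel lines, in coordinates\<close>

text \<open>As \<open>w\<close> and \<open>d\<close> are independent, a common point has the same
  parameter \<open>s\<close> on both segments. So they meet iff the affine function
  \<open>(1 - s) * (x - x') + s * (y - y')\<close> has a zero in [0,1], that is, iff its values at 0
  and 1 do not have the same strict sign.\<close>

lemma closed_segments_between_parallels_meet_iff:
  fixes p w d :: "'b::real_vector"
  assumes d: "d \<noteq> 0" and indep: "\<And>t. w \<noteq> t *\<^sub>R d"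
  shows "closed_segment (p + x *\<^sub>R d) (p + w + y *\<^sub>R d) \<inter>
         closed_segment (p + x' *\<^sub>R d) (p + w + y' *\<^sub>R d) \<noteq> {} \<longleftrightarrow> (x - x') * (y - y') \<le> 0"
    (is "?L \<longleftrightarrow> ?R")
proof -
  have pt: "(1 - s) *\<^sub>R (p + x *\<^sub>R d) + s *\<^sub>R (p + w + y *\<^sub>R d) =
      p + s *\<^sub>R w + ((1 - s) * x + s * y) *\<^sub>R d" for s x y
    by (simp add: algebra_simps)
  show ?thesis
  proof
    assume ?L
    then obtain s t where s: "0 \<le> s" "s \<le> 1" and
      eq: "p + s *\<^sub>R w + ((1 - s) * x + s * y) *\<^sub>R d = p + t *\<^sub>R w + ((1 - t) * x' + t * y') *\<^sub>R d"
      unfolding closed_segment_def pt by auto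
    have st: "s = t"
    proof (rule ccontr)
      assume "s \<noteq> t"
      let ?r = "((1 - t) * x' + t * y') - ((1 - s) * x + s * y)"
      have "(s - t) *\<^sub>R w = ?r *\<^sub>R d"
        using eq by (simp add: algebra_simps)
      then have "inverse (s - t) *\<^sub>R (s - t) *\<^sub>R w = (inverse (s - t) * ?r) *\<^sub>R d"
        by (metis scaleR_scaleR)
      with \<open>s \<noteq> t\<close> have "w = (inverse (s - t) * ?r) *\<^sub>R d"
        by simp
      with indep show False by blast
    qed
    with eq d have "(1 - s) * x + s * y = (1 - s) * x' + s * y'"
      by simp
    then have bal: "(1 - s) * (x - x') = - (s * (y - y'))"
      by (simp add: algebra_simps)
    show ?R
    proof (rule ccontr)
      assume "\<not> ?R"
      then have pos: "0 < (x - x') * (y - y')" by simp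
      \<comment> \<open>Multiplied by \<open>x - x'\<close>, the relation \<open>bal\<close> is a
        vanishing sum of two nonnegative terms. The second gives \<open>s = 0\<close>, then the
        first gives \<open>x = x'\<close>, against \<open>pos\<close>.\<close>
      have "(1 - s) * (x - x')\<^sup>2 + s * ((x - x') * (y - y')) =
          (x - x') * ((1 - s) * (x - x') + s * (y - y'))"
        by (simp add: algebra_simps power2_eq_square)
      also have "\<dots> = 0"
        using bal by simp
      finally have "(1 - s) * (x - x')\<^sup>2 = 0 \<and> s * ((x - x') * (y - y')) = 0"
        using s pos by (subst (asm) add_nonneg_eq_0_iff) auto
      with pos show False by auto
    qed
  next
    assume R: ?R
    have "\<exists>s. 0 \<le> s \<and> s \<le> 1 \<and> (1 - s) * x + s * y = (1 - s) * x' + s * y'"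
    proof (cases "x - x' = y - y'")
      case True
      with R have "x = x'"
        by (auto simp: mult_le_0_iff)
      then show ?thesis by (intro exI[of _ 0]) simp
    next
      case False
      \<comment> \<open>The zero of the affine function. In the other case that function is
        constant, and the sign condition makes it zero.\<close>
      define s where "s = (x - x') / ((x - x') - (y - y'))"
      have "s * ((x - x') - (y - y')) = x - x'"
        using False by (simp add: s_def)
      then have "(1 - s) * x + s * y = (1 - s) * x' + s * y'"
        by (simp add: algebra_simps)
      moreover have "0 \<le> s" "s \<le> 1"
        using R False by (auto simp: s_def mult_le_0_iff divide_simps)
      ultimately show ?thesis by blast
    qed
    then obtain s where s: "0 \<le> s" "s \<le> 1" "(1 - s) * x + s * y = (1 - s) * x' + s * y'"
      by blast
    have "p + s *\<^sub>R w + ((1 - s) * x + s * y) *\<^sub>R d \<in>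
        closed_segment (p + x *\<^sub>R d) (p + w + y *\<^sub>R d) \<inter>
        closed_segment (p + x' *\<^sub>R d) (p + w + y' *\<^sub>R d)"
      unfolding closed_segment_def pt using s by (intro IntI CollectI exI[of _ s]) simp_all
    then show ?L by blast
  qed
qed

lemma parallel_lines_parametrization:
  assumes "parallel_lines L M"
  shows "\<exists>p w d. d \<noteq> 0 \<and> (\<forall>t. w \<noteq> t *\<^sub>R d) \<and>
    (\<forall>z\<in>L. \<exists>t. z = p + t *\<^sub>R d) \<and> (\<forall>z\<in>M. \<exists>t. z = p + w + t *\<^sub>R d)"
proof -
  have aff: "affine L" and dim: "aff_dim L = 1" and ne: "L \<noteq> M" and "affine_parallel L M"
    using assms by (auto simp: parallel_lines_def)
  then obtain w where M: "M = (+) w ` L"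
    by (auto simp: affine_parallel_def)
  obtain p where p: "p \<in> L"
    using dim by (metis aff_dim_empty ex_in_conv one_neq_neg_one)
  define U where "U = (+) (- p) ` L"
  have subU: "subspace U"
    unfolding U_def using aff p by (rule affine_diffs_subspace)
  have "aff_dim U = 1"
    unfolding U_def using dim by (simp only: aff_dim_translation_eq)
  then have "dim U = 1"
    using aff_dim_subspace[OF subU] by simp
  then obtain B where B: "B \<subseteq> U" "independent B" "U \<subseteq> span B" "card B = 1"
    by (metis basis_exists)
  then obtain d where "B = {d}"
    by (auto simp: card_1_singleton_iff)
  with B subU have d: "d \<noteq> 0" and U: "U = span {d}"
    by (auto simp: dependent_single intro: span_minimal[THEN subsetD])
  have L: "L = (\<lambda>t. p + t *\<^sub>R d) ` UNIV"
  proof -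
    have "L = (+) p ` U"
      by (auto simp: U_def image_image)
    then show ?thesis
      by (auto simp: U span_singleton)
  qed
  \<comment> \<open>Translation by a multiple of \<open>d\<close> maps \<open>L\<close> onto itself,
    which would make the two lines coincide.\<close>
  have "w \<noteq> t *\<^sub>R d" for t
  proof
    assume w: "w = t *\<^sub>R d"
    have shift: "z + r *\<^sub>R d \<in> L" if z: "z \<in> L" for z r
    proof -
      obtain s where "z = p + s *\<^sub>R d"
        using z L by blast
      then have "z + r *\<^sub>R d = p + (s + r) *\<^sub>R d"
        by (simp add: algebra_simps)
      then show ?thesis
        using L by blast
    qed
    have "z = w + (z + (- t) *\<^sub>R d)" "w + z = z + t *\<^sub>R d" for z
      by (simp_all add: w)
    then have "M = L"
      unfolding M using shift by (metis equalityI image_eqI image_subsetI subsetI)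
    with ne show False by simp
  qed
  moreover have "\<forall>z\<in>L. \<exists>t. z = p + t *\<^sub>R d"
    by (auto simp: L)
  moreover have "\<forall>z\<in>M. \<exists>t. z = p + w + t *\<^sub>R d"
    by (auto simp: L M algebra_simps)
  ultimately show ?thesis
    using d by blast
qed

lemma permutation_graph_coordinates:
  assumes "permutation_graph G"
  obtains x y :: "'a \<Rightarrow> real" where
    "\<And>u v. u \<in> pverts G \<Longrightarrow> v \<in> pverts G \<Longrightarrow> u \<noteq> v \<Longrightarrow>
       (u, v) \<in> parcs G \<longleftrightarrow> (x u - x v) * (y u - y v) \<le> 0"
proof -
  obtain L M a b where LM: "parallel_lines L M"
    and ab: "\<forall>v\<in>pverts G. a v \<in> L \<and> b v \<in> M"
    and adj: "\<forall>u\<in>pverts G. \<forall>v\<in>pverts G. u \<noteq> v \<longrightarrow>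
       ((u, v) \<in> parcs G \<longleftrightarrow> closed_segment (a u) (b u) \<inter> closed_segment (a v) (b v) \<noteq> {})"
    using assms unfolding permutation_graph_def by blast
  obtain p w d where pwd: "d \<noteq> 0 \<and> (\<forall>t. w \<noteq> t *\<^sub>R d) \<and>
      (\<forall>z\<in>L. \<exists>t. z = p + t *\<^sub>R d) \<and> (\<forall>z\<in>M. \<exists>t. z = p + w + t *\<^sub>R d)"
    using parallel_lines_parametrization[OF LM] by (elim exE) (rule that)
  then have d: "d \<noteq> 0" and indep: "\<And>t. w \<noteq> t *\<^sub>R d"
    by simp_all
  have "\<forall>v\<in>pverts G. \<exists>t. a v = p + t *\<^sub>R d" "\<forall>v\<in>pverts G. \<exists>t. b v = p + w + t *\<^sub>R d"
    using pwd ab by simp_all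
  from bchoice[OF this(1)] bchoice[OF this(2)]
  obtain x y where xy: "\<forall>v\<in>pverts G. a v = p + x v *\<^sub>R d"
    "\<forall>v\<in>pverts G. b v = p + w + y v *\<^sub>R d"
    by blast
  show ?thesis
  proof
    show "(u, v) \<in> parcs G \<longleftrightarrow> (x u - x v) * (y u - y v) \<le> 0"
      if "u \<in> pverts G" "v \<in> pverts G" "u \<noteq> v" for u v
      using adj xy that
        closed_segments_between_parallels_meet_iff[OF d indep, of p "x u" "y u" "x v" "y v"]
      by simp
  qed
qed

section \<open>Levels of a transitive orientation\<close>

text \<open>\<open>h v\<close> is the length of a longest \<open>P\<close>-chain ending at
  \<open>v\<close>. By transitivity the vertices of a chain are pairwise related, so they have
  distinct colours, which bounds the length.\<close>

lemma height_function:
  fixes c :: "'a \<Rightarrow> nat"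
  assumes trans: "transp P" and field: "\<And>u v. P u v \<Longrightarrow> u \<in> V \<and> v \<in> V"
    and proper: "\<And>u v. P u v \<Longrightarrow> c u \<noteq> c v" and range: "c ` V \<subseteq> {..<k}"
  obtains h where "\<And>v. v \<in> V \<Longrightarrow> h v < k" "\<And>u v. P u v \<Longrightarrow> h u < h v"
    "\<And>v m. h v = Suc m \<Longrightarrow> \<exists>u. P u v \<and> h u = m"
proof -
  define R where "R v n \<longleftrightarrow> (\<exists>u. (P ^^ n) u v)" for v n
  define h where "h v = (GREATEST n. R v n)" for v
  \<comment> \<open>The induction counts colours instead of vertices: all earlier vertices are below
    the new one, so each step adds a colour.\<close>
  have chain: "\<exists>C\<subseteq>V. card (c ` C) = Suc n \<and> finite C \<and> v \<in> C \<and> (\<forall>w\<in>C. w = v \<or> P w v)"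
    if "v \<in> V" "(P ^^ n) u v" for n u v
    using that
  proof (induction n arbitrary: v)
    case 0
    then show ?case by (intro exI[of _ "{v}"]) auto
  next
    case (Suc n)
    then obtain w where w: "(P ^^ n) u w" "P w v" by auto
    then obtain C where C: "C \<subseteq> V" "card (c ` C) = Suc n" "finite C" "\<forall>z\<in>C. z = w \<or> P z w"
      using Suc.IH field by blast
    then have below: "\<forall>z\<in>C. P z v"
      using w(2) trans by (metis transpD)
    then have "c v \<notin> c ` C"
      using proper by force
    with C below Suc.prems show ?case
      by (intro exI[of _ "insert v C"]) auto
  qed
  have bound: "n < k" if R: "R v n" and v: "v \<in> V" for v n
  proof -
    obtain C where "C \<subseteq> V" "card (c ` C) = Suc n"
      using R chain[OF v] unfolding R_def by blast
    moreover have "card (c ` C) \<le> card {..<k}"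
      using range \<open>C \<subseteq> V\<close> by (intro card_mono) auto
    ultimately show ?thesis by simp
  qed
  have R0: "R v 0" for v
    by (auto simp: R_def)
  have outside: "n = 0" if "R v n" "v \<notin> V" for v n
    using that field by (cases n) (auto simp: R_def)
  have bd: "\<forall>n. R v n \<longrightarrow> n \<le> k" for v
    using bound outside by (metis le_eq_less_or_eq zero_le)
  have Rh: "R v (h v)" for v
    unfolding h_def using R0[of v] bd[of v] by (metis GreatestI_nat)
  have le: "n \<le> h v" if "R v n" for v n
    unfolding h_def using that bd[of v] by (metis Greatest_le_nat)
  have mono: "h u < h v" if "P u v" for u v
  proof -
    have "R v (Suc (h u))"
      using Rh[of u] that by (auto simp: R_def)
    then show ?thesis using le by fastforce
  qed
  show ?thesis
  proof
    show "h v < k" if "v \<in> V" for v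
      using Rh bound that by blast
    show "h u < h v" if "P u v" for u v
      using that by (rule mono)
    show "\<exists>u. P u v \<and> h u = m" if "h v = Suc m" for v m
    proof -
      have "R v (Suc m)"
        using Rh[of v] that by simp
      then obtain u w where "(P ^^ m) u w" "P w v"
        by (auto simp: R_def)
      \<comment> \<open>A longest chain without its last step ends at height at least
        \<open>m\<close>, and monotonicity allows no more.\<close>
      then have "m \<le> h w" "h w < Suc m"
        using le[of w m] mono[of w v] that by (auto simp: R_def)
      with \<open>P w v\<close> show ?thesis by auto
    qed
  qed
qed

section \<open>Three colours for one level\<close>

lemma conflict_free_coloring_of_independent_set:
  assumes Q: "transp Q" "irreflp Q"
    and E: "\<And>u v. u \<in> A \<union> S \<Longrightarrow> v \<in> A \<union> S \<Longrightarrow> E u v \<longleftrightarrow> u \<noteq> v \<and> \<not> Q u v \<and> \<not> Q v u"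
    and fin: "finite A"
    and A: "\<And>u v. u \<in> A \<Longrightarrow> v \<in> A \<Longrightarrow> \<not> E u v"
    and S: "\<And>u v. u \<in> S \<Longrightarrow> v \<in> S \<Longrightarrow> \<not> E u v"
    and hit: "\<And>s. s \<in> S \<Longrightarrow> \<exists>u\<in>A. E s u"
  obtains d :: "'a \<Rightarrow> nat" where "\<And>u. d u < 3"
    "\<And>s. s \<in> S \<Longrightarrow> \<exists>i. \<exists>!u. u \<in> A \<and> E s u \<and> d u = i"
proof -
  have tr: "Q u w" if "Q u v" "Q v w" for u v w
    using Q(1) that by (rule transpD)
  have irr: "\<not> Q u u" for u
    using Q(2) by (simp add: irreflpD)
  define hits where "hits H \<longleftrightarrow> (\<forall>s\<in>S. \<exists>u\<in>H. E s u)" for H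
  obtain H where H: "H \<subseteq> A" "hits H" and min: "\<And>H'. H' \<subseteq> A \<Longrightarrow> hits H' \<Longrightarrow> H' \<subseteq> H \<Longrightarrow> H' = H"
  proof -
    have "finite {H. H \<subseteq> A \<and> hits H}" "A \<in> {H. H \<subseteq> A \<and> hits H}"
      using fin hit by (auto simp: hits_def)
    from finite_has_minimal2[OF this] obtain H where
      "H \<in> {H. H \<subseteq> A \<and> hits H}" "\<forall>H'\<in>{H. H \<subseteq> A \<and> hits H}. H' \<subseteq> H \<longrightarrow> H = H'"
      by blast
    then show ?thesis
      by (intro that[of H]) auto
  qed
  \<comment> \<open>By minimality some \<open>s\<close> has \<open>m2\<close> as its only neighbour
    in \<open>H\<close>. Being adjacent to \<open>m2\<close> but not to \<open>m1\<close> or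
    \<open>m3\<close>, it lies \<open>Q\<close>-between these two. As \<open>S\<close> is
    independent, \<open>t\<close> is \<open>Q\<close>-comparable to \<open>s\<close>, hence by
    transitivity to \<open>m1\<close> or \<open>m3\<close>, although adjacent to both.\<close>
  have no3: False
    if "t \<in> S" "m1 \<in> H" "m2 \<in> H" "m3 \<in> H" "Q m1 m2" "Q m2 m3" "E t m1" "E t m2" "E t m3"
    for t m1 m2 m3
  proof -
    have "\<not> hits (H - {m2})"
      using min[of "H - {m2}"] H \<open>m2 \<in> H\<close> by blast
    then obtain s where s: "s \<in> S" "\<And>u. u \<in> H \<Longrightarrow> u \<noteq> m2 \<Longrightarrow> \<not> E s u"
      unfolding hits_def by blast
    then have s2: "E s m2"
      using H(2) unfolding hits_def by blast
    have ne: "m1 \<noteq> m2" "m3 \<noteq> m2"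
      using that irr by auto
    have mem: "m1 \<in> A \<union> S" "m2 \<in> A \<union> S" "m3 \<in> A \<union> S" "s \<in> A \<union> S" "t \<in> A \<union> S"
      using that s H by auto
    have "\<not> E s m1" "\<not> E s m3"
      using s ne that by auto
    \<comment> \<open>Adjacency to \<open>m2\<close> keeps \<open>s\<close> out of the independent
      set \<open>A\<close>, and \<open>t\<close> differs from \<open>s\<close> by being adjacent to
      \<open>m1\<close>.\<close>
    have "s \<noteq> m1" "s \<noteq> m3" "s \<noteq> t"
      using A H s s2 that ne \<open>\<not> E s m1\<close> by blast+
    have "Q m1 s"
      using E[OF mem(4,1)] E[OF mem(4,2)] \<open>\<not> E s m1\<close> \<open>s \<noteq> m1\<close> s2 tr \<open>Q m1 m2\<close> by blast
    moreover have "Q s m3"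
      using E[OF mem(4,3)] E[OF mem(4,2)] \<open>\<not> E s m3\<close> \<open>s \<noteq> m3\<close> s2 tr \<open>Q m2 m3\<close> by blast
    moreover have "Q s t \<or> Q t s"
      using E[OF mem(4,5)] S[OF s(1) that(1)] \<open>s \<noteq> t\<close> by blast
    ultimately show False
      using E[OF mem(5,1)] E[OF mem(5,3)] that tr by blast
  qed
  \<comment> \<open>\<open>Q\<close> orders the independent set \<open>H\<close> linearly, and
    \<open>idx\<close> is the position in this order. Colour 0 is kept for vertices outside
    \<open>H\<close>, so they cannot repeat a colour used on \<open>H\<close>.\<close>
  define idx where "idx u = card {m \<in> H. Q m u}" for u
  define d where "d u = (if u \<in> H then Suc (idx u mod 2) else 0)" for u
  have finH: "finite H"
    using H fin finite_subset by blast
  have differ: "d m1 \<noteq> d m2"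
    if "t \<in> S" "m1 \<in> H" "m2 \<in> H" "Q m1 m2" "E t m1" "E t m2" for t m1 m2
  proof -
    \<comment> \<open>If \<open>t\<close> were \<open>Q\<close>-comparable to such an
      \<open>m\<close>, it would be comparable to \<open>m1\<close> or \<open>m2\<close>; so
      \<open>m\<close> is a third neighbour of \<open>t\<close>, which \<open>no3\<close>
      excludes.\<close>
    have between: "\<not> (Q m1 m \<and> Q m m2)" if "m \<in> H" for m
    proof
      assume m: "Q m1 m \<and> Q m m2"
      have mem: "m1 \<in> A \<union> S" "m2 \<in> A \<union> S" "m \<in> A \<union> S" "t \<in> A \<union> S"
        using \<open>m1 \<in> H\<close> \<open>m2 \<in> H\<close> that \<open>t \<in> S\<close> H by auto
      have "t \<noteq> m"
        using \<open>E t m1\<close> A \<open>m1 \<in> H\<close> H that by blast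
      then have "E t m"
        using E[OF mem(4,1)] E[OF mem(4,2)] E[OF mem(4,3)] m \<open>E t m1\<close> \<open>E t m2\<close> tr by blast
      with no3[OF \<open>t \<in> S\<close> \<open>m1 \<in> H\<close> that \<open>m2 \<in> H\<close>] m \<open>E t m1\<close> \<open>E t m2\<close> show False by blast
    qed
    have lin: "m = m1 \<or> Q m m1 \<or> Q m1 m" if "m \<in> H" for m
      using E[of m m1] A[of m m1] that \<open>m1 \<in> H\<close> H by blast
    have "{m \<in> H. Q m m2} = insert m1 {m \<in> H. Q m m1}"
      using between lin tr \<open>m1 \<in> H\<close> \<open>Q m1 m2\<close> by blast
    then have "idx m2 = Suc (idx m1)"
      using finH irr by (simp add: idx_def)
    then show ?thesis
      using that by (simp add: d_def mod_Suc)
  qed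
  show ?thesis
  proof
    show "d u < 3" for u
      by (simp add: d_def)
    fix s assume s: "s \<in> S"
    define N where "N = {u \<in> H. E s u}"
    have lin: "u = v \<or> Q u v \<or> Q v u" if "u \<in> H" "v \<in> H" for u v
      using E[of u v] A[of u v] that H by blast
    obtain u where u: "u \<in> H" "E s u"
      using H(2) s unfolding hits_def by blast
    have inj: "v = u" if "v \<in> A" "E s v" "d v = d u" for v
    proof (rule ccontr)
      assume "v \<noteq> u"
      have "v \<in> H"
        using that u by (auto simp: d_def split: if_splits)
      then show False
        using lin[of u v] differ[OF s, of u v] differ[OF s, of v u] u that \<open>v \<noteq> u\<close> by auto
    qed
    show "\<exists>i. \<exists>!u. u \<in> A \<and> E s u \<and> d u = i"
      using u H inj by blast
  qed
qed

section \<open>Combining the levels\<close>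

lemma pcf_coloring_from_orientations:
  assumes fin: "finite (pverts G)"
    and P: "transp P"
    and PE: "\<And>u v. (u, v) \<in> parcs G \<longleftrightarrow> P u v \<or> P v u"
    and field: "\<And>u v. P u v \<Longrightarrow> u \<in> pverts G \<and> v \<in> pverts G"
    and Q: "transp Q" "irreflp Q"
    and QE: "\<And>u v. u \<in> pverts G \<Longrightarrow> v \<in> pverts G \<Longrightarrow>
       (u, v) \<in> parcs G \<longleftrightarrow> u \<noteq> v \<and> \<not> Q u v \<and> \<not> Q v u"
    and c: "proper_coloring G k c"
  shows "\<exists>c. pcf_coloring G (3 * k) c"
proof -
  let ?V = "pverts G"
  have "c u \<noteq> c v" if "P u v" for u v
    using c that PE[of u v] by (auto simp: proper_coloring_def)
  moreover have "c ` ?V \<subseteq> {..<k}"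
    using c by (simp add: proper_coloring_def)
  ultimately obtain h where hk: "\<And>v. v \<in> ?V \<Longrightarrow> h v < k"
    and mono: "\<And>u v. P u v \<Longrightarrow> h u < h v"
    and pred: "\<And>v m. h v = Suc m \<Longrightarrow> \<exists>u. P u v \<and> h u = m"
    using height_function[OF P field, of c k] by blast
  define N where "N = neighborhood G"
  have N: "u \<in> N v \<longleftrightarrow> (v, u) \<in> parcs G" for u v
    by (simp add: N_def neighborhood_def)
  have NV: "N v \<subseteq> ?V" for v
    using field by (auto simp: N PE)
  then have finN: "finite (N v)" for v
    using fin finite_subset by blast
  have h_ne: "h u \<noteq> h v" if "(u, v) \<in> parcs G" for u v
    using that mono PE by (metis less_irrefl)
  \<comment> \<open>For an isolated vertex of level 0 this is the maximum of an empty set; the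
    condition \<open>N v \<noteq> {}\<close> in \<open>S\<close> discards that value.\<close>
  define target where "target v = (if h v = 0 then Max (h ` N v) else h v - 1)" for v
  define A where "A j = {v \<in> ?V. h v = j}" for j
  define S where "S j = {v \<in> ?V. N v \<noteq> {} \<and> target v = j}" for j
  have hit: "\<exists>u\<in>A j. (s, u) \<in> parcs G" if "s \<in> S j" for s j
  proof (cases "h s")
    case 0
    with that have "Max (h ` N s) = j" "N s \<noteq> {}"
      by (auto simp: S_def target_def)
    then have "j \<in> h ` N s"
      using Max_in[of "h ` N s"] finN by auto
    then show ?thesis
      using NV[of s] by (auto simp: A_def N)
  next
    case (Suc m)
    with that have "m = j"
      by (simp add: S_def target_def)
    with pred[OF Suc] field show ?thesis
      by (auto simp: A_def PE)
  qed
  \<comment> \<open>Since \<open>v\<close> has positive level and looks into level \<open>j\<close>,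
    it lies in level \<open>j + 1\<close>. If \<open>u\<close> has level 0, then \<open>v\<close> is
    a neighbour above its highest neighbour level \<open>j\<close>; otherwise \<open>u\<close> also
    has level \<open>j + 1\<close>, against monotonicity.\<close>
  have indep: "\<not> P u v" if "u \<in> S j" "v \<in> S j" for u v j
  proof
    assume uv: "P u v"
    then have hv: "h v = Suc j"
      using mono[OF uv] that by (auto simp: S_def target_def split: if_splits)
    have v: "v \<in> N u"
      using uv by (simp add: N PE)
    show False
    proof (cases "h u = 0")
      case True
      then have "Max (h ` N u) = j"
        using that by (simp add: S_def target_def)
      moreover have "h v \<le> Max (h ` N u)"
        using finN v by simp
      ultimately show False
        using hv by simp
    next
      case False
      then show False
        using that hv mono[OF uv] by (auto simp: S_def target_def)
    qed
  qed
  have "\<exists>d::_ \<Rightarrow> nat. (\<forall>u. d u < 3) \<and>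
      (\<forall>s\<in>S j. \<exists>i. \<exists>!u. u \<in> A j \<and> (s, u) \<in> parcs G \<and> d u = i)" for j
  proof (rule conflict_free_coloring_of_independent_set
      [OF Q, where A = "A j" and S = "S j" and E = "\<lambda>u v. (u, v) \<in> parcs G"])
    show "(u, v) \<in> parcs G \<longleftrightarrow> u \<noteq> v \<and> \<not> Q u v \<and> \<not> Q v u"
      if "u \<in> A j \<union> S j" "v \<in> A j \<union> S j" for u v
      using that QE[of u v] by (auto simp: A_def S_def)
    show "finite (A j)"
      using fin by (simp add: A_def)
    show "(u, v) \<notin> parcs G" if "u \<in> A j" "v \<in> A j" for u v
      using that h_ne[of u v] by (auto simp: A_def)
    show "(u, v) \<notin> parcs G" if "u \<in> S j" "v \<in> S j" for u v
      using that indep by (auto simp: PE)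
    show "\<exists>u\<in>A j. (s, u) \<in> parcs G" if "s \<in> S j" for s
      using that by (rule hit)
  qed blast
  then obtain d :: "nat \<Rightarrow> _ \<Rightarrow> nat" where d3: "\<And>j u. d j u < 3"
    and d: "\<And>j s. s \<in> S j \<Longrightarrow> \<exists>i. \<exists>!u. u \<in> A j \<and> (s, u) \<in> parcs G \<and> d j u = i"
    by metis
  \<comment> \<open>Quotient and remainder by 3 recover level and local colour, so the levels have
    disjoint palettes. Thus \<open>f\<close> is proper because edges join different levels, and a
    colour unique within the target level is unique in the whole neighbourhood.\<close>
  define f where "f v = 3 * h v + d (h v) v" for v
  have f_eq: "f u = 3 * j + i \<longleftrightarrow> h u = j \<and> d j u = i" if "i < 3" for u i j
  proof -
    have "f u = 3 * j + i \<longleftrightarrow> h u = j \<and> d (h u) u = i"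
      using d3[of "h u" u] that unfolding f_def by presburger
    then show ?thesis by blast
  qed
  have "proper_coloring G (3 * k) f"
    unfolding proper_coloring_def
  proof (intro conjI)
    show "f ` ?V \<subseteq> {..<3 * k}"
    proof clarify
      fix v assume "v \<in> ?V"
      then show "f v < 3 * k"
        using hk[of v] d3[of "h v" v] by (simp add: f_def)
    qed
    show "\<forall>(u, v)\<in>parcs G. f u \<noteq> f v"
      using h_ne f_eq[OF d3] by (metis (mono_tags, lifting) case_prodI2 f_def)
  qed
  moreover have "\<exists>i. \<exists>!u. u \<in> N v \<and> f u = i" if v: "v \<in> ?V" "N v \<noteq> {}" for v
  proof -
    define j where "j = target v"
    have "v \<in> S j"
      using v by (simp add: S_def j_def)
    from d[OF this] obtain i u where u: "u \<in> A j" "(v, u) \<in> parcs G" "d j u = i"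
      and uniq: "\<And>u'. u' \<in> A j \<Longrightarrow> (v, u') \<in> parcs G \<Longrightarrow> d j u' = i \<Longrightarrow> u' = u"
      by blast
    have "i < 3"
      using d3 u by blast
    have "u \<in> N v \<and> f u = 3 * j + i"
      using u f_eq[OF \<open>i < 3\<close>] by (simp add: N A_def)
    moreover have "u' = u" if "u' \<in> N v \<and> f u' = 3 * j + i" for u'
      using that uniq f_eq[OF \<open>i < 3\<close>] NV[of v] by (auto simp: N A_def)
    ultimately show ?thesis by blast
  qed
  ultimately show ?thesis
    unfolding pcf_coloring_def N_def by blast
qed

section \<open>The two orientations of a permutation graph\<close>

theorem theorem1p4:
  fixes G :: "'a pair_pre_digraph"
  assumes "permutation_graph G"
  shows "pcf_chromatic_number G \<le> 3 * chromatic_number G"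
proof -
  interpret pair_graph G
    using assms by (simp add: permutation_graph_def)
  let ?V = "pverts G"
  obtain x y :: "'a \<Rightarrow> real" where xy: "\<And>u v. u \<in> ?V \<Longrightarrow> v \<in> ?V \<Longrightarrow> u \<noteq> v \<Longrightarrow>
       (u, v) \<in> parcs G \<longleftrightarrow> (x u - x v) * (y u - y v) \<le> 0"
    using permutation_graph_coordinates[OF assms] by blast
  have noloop: "(v, v) \<notin> parcs G" for v
    using pair_no_loops by fastforce
  obtain e :: "'a \<Rightarrow> nat" where e: "inj_on e ?V"
    using finite_imp_inj_to_nat_seg[OF pair_finite_verts] by blast
  \<comment> \<open>An injective colouring shows that the minimum defining
    \<open>chromatic_number\<close> is attained.\<close>
  have "proper_coloring G (Suc (Max (e ` ?V))) e"
    using e noloop in_arcsD1 in_arcsD2 pair_finite_verts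
    by (auto simp: proper_coloring_def less_Suc_eq_le dest: inj_onD)
  then obtain c where c: "proper_coloring G (chromatic_number G) c"
    unfolding chromatic_number_def using LeastI_ex[of "\<lambda>k. \<exists>c. proper_coloring G k c"] by blast
  \<comment> \<open>\<open>e\<close> breaks the tie between vertices represented by the same segment.\<close>
  define P where "P u v \<longleftrightarrow> u \<in> ?V \<and> v \<in> ?V \<and> x u \<le> x v \<and> y v \<le> y u \<and>
      (x u = x v \<and> y u = y v \<longrightarrow> e u < e v)" for u v
  \<comment> \<open>Disjoint segments are ordered from left to right; intersecting ones are oriented
    by \<open>P\<close>, along the first line and against the second.\<close>
  define Q where "Q u v \<longleftrightarrow> x u < x v \<and> y u < y v" for u v
  have PE: "(u, v) \<in> parcs G \<longleftrightarrow> P u v \<or> P v u" for u v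
  proof (cases "u \<in> ?V \<and> v \<in> ?V \<and> u \<noteq> v")
    case True
    then have "e u \<noteq> e v"
      using e by (auto dest: inj_onD)
    with True xy[of u v] show ?thesis
      unfolding P_def mult_le_0_iff by (smt (verit) nat_neq_iff)
  next
    case False
    then show ?thesis
      using noloop[of u] in_arcsD1[of u v] in_arcsD2[of u v] by (auto simp: P_def)
  qed
  have "\<exists>c. pcf_coloring G (3 * chromatic_number G) c"
  proof (rule pcf_coloring_from_orientations[OF pair_finite_verts _ PE _ _ _ _ c])
    show "transp P"
      by (rule transpI) (auto simp: P_def)
    show "P u v \<Longrightarrow> u \<in> ?V \<and> v \<in> ?V" for u v
      by (simp add: P_def)
    show "transp Q" "irreflp Q"
      by (auto simp: Q_def intro!: transpI irreflpI)
    show "(u, v) \<in> parcs G \<longleftrightarrow> u \<noteq> v \<and> \<not> Q u v \<and> \<not> Q v u" if "u \<in> ?V" "v \<in> ?V" for u v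
      using xy[OF that] noloop by (cases "u = v") (auto simp: Q_def mult_le_0_iff)
  qed
  then show ?thesis
    unfolding pcf_chromatic_number_def by (rule Least_le)
qed

end
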